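(* The homogeneous problem $$\text{find } u\in\mathcal H_0\text{ such that } a(u,v_h)=0\quad\forall v_h\in V_h$$ admits nontrivial solutions. In particular, there exists $\Phi\in\mathcal H_0\setminus\{0\}$ such that $a(\Phi,v_h)=0$ for all $v_h\in V_h$. Consequently, since $0\in\mathcal H_0$, the solution of the homogeneous problem is not unique in $\mathcal H_0$.
   Context: Let $U$ be a (real) Hilbert space and let $V_h\subset U$ be a finite-dimensional subspace (test space) with $\dim(V_h)=n<\infty$. Let $\mathcal A\subset U$ be the admissible trial space and $\mathcal H\subseteq\mathcal A$ the admissible neural trial class. Let $a(\cdot,\cdot):U\times V_h\to\mathbb R$ be a bilinear form. Let $\mathcal H_0\subset U$ be a homogeneous neural perturbation class, i.e. a set that is closed under finite linear combinations, contains at least $n+1$ linearly independent functions, and preserves admissibility in the sense that $u\in\mathcal H$ and $\Phi\in\mathcal H_0$ imply $u+\Phi\in\mathcal H$. *)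

theory Defs
  imports "HOL-Analysis.Analysis"
begin

definition finite_dim_subspace :: "'u::real_vector set \<Rightarrow> bool" where
  "finite_dim_subspace V \<longleftrightarrow> subspace V \<and> (\<exists>B. finite B \<and> span B = V)"

(* The form lives on U x V only: its values at (u, v) with v outside V are irrelevant,
   so the library's total notion of bilinearity would be too strong. *)
definition bilinear_form_on :: "'u::real_vector set \<Rightarrow> ('u \<Rightarrow> 'u \<Rightarrow> real) \<Rightarrow> bool" where
  "bilinear_form_on V a \<longleftrightarrow>
     (\<forall>v\<in>V. linear (\<lambda>u. a u v)) \<and>
     (\<forall>u. \<forall>v\<in>V. \<forall>w\<in>V. a u (v + w) = a u v + a u w) \<and>
     (\<forall>u. \<forall>v\<in>V. \<forall>r. a u (r *\<^sub>R v) = r * a u v)"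

definition closed_under_lincomb :: "'u::real_vector set \<Rightarrow> bool" where
  "closed_under_lincomb W \<longleftrightarrow>
     (\<forall>S c. finite S \<and> S \<subseteq> W \<longrightarrow> (\<Sum>x\<in>S. c x *\<^sub>R x) \<in> W)"

definition homogeneous_perturbation_class ::
    "nat \<Rightarrow> 'u::real_vector set \<Rightarrow> 'u set \<Rightarrow> bool" where
  "homogeneous_perturbation_class n H H0 \<longleftrightarrow>
     closed_under_lincomb H0 \<and>
     (\<exists>B\<subseteq>H0. card B = n + 1 \<and> independent B) \<and>
     (\<forall>u\<in>H. \<forall>\<Phi>\<in>H0. u + \<Phi> \<in> H)"

definition solves_homogeneous ::
    "('u \<Rightarrow> 'u \<Rightarrow> real) \<Rightarrow> 'u set \<Rightarrow> 'u set \<Rightarrow> 'u \<Rightarrow> bool" where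
  "solves_homogeneous a V H0 u \<longleftrightarrow> u \<in> H0 \<and> (\<forall>v\<in>V. a u v = 0)"

end

theory Submission
  imports Defs
begin

text \<open>
  The homogeneous problem imposes only \<open>n\<close> linear conditions, one for each vector of a basis \<open>E\<close> of
  the test space, on combinations of \<open>n + 1\<close> independent functions; hence some nonzero combination
  satisfies all of them.  The conditions are collected in the single map
  \<open>T u = (\<Sum>e\<in>E. a u e *\<^sub>R e)\<close>.  It is linear, it takes values in the \<open>n\<close>-dimensional test space, and
  since \<open>E\<close> is independent it vanishes at \<open>u\<close> exactly if every condition \<open>a u e = 0\<close> holds.
  By \<open>exists_nonzero_in_kernel\<close>, such a \<open>T\<close> has a nonzero zero in the span of the \<open>n + 1\<close> functions.
  That span lies in the perturbation class because the class is closed under linear combinations.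
  Non-uniqueness follows, as \<open>0\<close> is a second solution.
\<close>

text \<open>
  Were the map injective on the span of \<open>B\<close>, the image of \<open>B\<close> would be an independent set with more
  elements than \<open>E\<close> inside the span of \<open>E\<close>.
\<close>

lemma exists_nonzero_in_kernel:
  fixes f :: "'a::real_vector \<Rightarrow> 'b::real_vector"
  assumes f: "linear f" and B: "independent B"
    and E: "finite E" "f ` B \<subseteq> span E" and less: "card E < card B"
  obtains x where "x \<in> span B" "x \<noteq> 0" "f x = 0"
proof -
  have "\<not> inj_on f (span B)"
  proof
    assume inj: "inj_on f (span B)"
    then have "independent (f ` B)"
      by (rule linear_independent_injective_image[OF f B])
    then have "card (f ` B) \<le> card E"
      using independent_span_bound E by blast
    moreover have "card (f ` B) = card B"
      by (rule card_image[OF inj_on_subset[OF inj span_superset]])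
    ultimately show False
      using less by simp
  qed
  then obtain x y where xy: "x \<in> span B" "y \<in> span B" "x \<noteq> y" "f x = f y"
    by (auto simp: inj_on_def)
  show thesis
    by (rule that[of "x - y"]) (use xy f in \<open>auto simp: span_diff linear_diff\<close>)
qed

lemma closed_under_lincomb_zero: "closed_under_lincomb W \<Longrightarrow> 0 \<in> W"
  unfolding closed_under_lincomb_def by (drule spec[of _ "{}"]) simp

lemma closed_under_lincomb_span_subset:
  assumes "closed_under_lincomb W" "finite B" "B \<subseteq> W"
  shows "span B \<subseteq> W"
  using assms by (auto simp: closed_under_lincomb_def span_finite)

lemma bilinear_form_on_eq_0_on_span:
  assumes a: "bilinear_form_on V a" and V: "subspace V"
    and E: "E \<subseteq> V" "\<And>e. e \<in> E \<Longrightarrow> a u e = 0" and v: "v \<in> span E"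
  shows "a u v = 0"
proof -
  have zero: "a u 0 = 0"
  proof -
    have "a u (0 *\<^sub>R 0) = 0 * a u 0"
      using a subspace_0[OF V] unfolding bilinear_form_on_def by blast
    then show ?thesis by simp
  qed
  \<comment> \<open>Linearity in the second argument is known only on \<open>V\<close>, so membership in \<open>V\<close> is carried along.\<close>
  have "v \<in> V \<and> a u v = 0"
    using v
  proof (induction rule: span_induct_alt)
    case base
    then show ?case using zero subspace_0[OF V] by simp
  next
    case (step c x y)
    then have "x \<in> V" "c *\<^sub>R x \<in> V" "y \<in> V"
      using E V by (auto simp: subspace_scale)
    moreover from this have "a u (c *\<^sub>R x + y) = c * a u x + a u y"
      using a unfolding bilinear_form_on_def by simp
    ultimately show ?case
      using step E(2) V by (simp add: subspace_add)
  qed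
  then show ?thesis ..
qed

theorem theorem5p1:
  fixes Vh A H H0 :: "'u::{real_inner, complete_space} set"
    and a :: "'u \<Rightarrow> 'u \<Rightarrow> real"
    and n :: nat
  assumes "finite_dim_subspace Vh"
    and "dim Vh = n"
    and "H \<subseteq> A"
    and "bilinear_form_on Vh a"
    and "homogeneous_perturbation_class n H H0"
  shows "(\<exists>u. solves_homogeneous a Vh H0 u \<and> u \<noteq> 0) \<and>
         (\<exists>\<Phi>\<in>H0 - {0}. \<forall>v\<in>Vh. a \<Phi> v = 0) \<and>
         0 \<in> H0 \<and>
         \<not> (\<exists>!u. solves_homogeneous a Vh H0 u)"
proof -
  have V: "subspace Vh"
    using assms(1) by (simp add: finite_dim_subspace_def)
  obtain G where G: "finite G" "span G = Vh"
    using assms(1) by (auto simp: finite_dim_subspace_def)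
  obtain E where E: "E \<subseteq> Vh" "independent E" "Vh \<subseteq> span E" "card E = n"
    using basis_exists[of Vh] assms(2) by auto
  have finE: "finite E"
    using independent_span_bound[OF G(1) E(2)] E(1) G(2) by blast
  have H0: "closed_under_lincomb H0"
    using assms(5) by (simp add: homogeneous_perturbation_class_def)
  obtain B where B: "B \<subseteq> H0" "card B = n + 1" "independent B"
    using assms(5) by (auto simp: homogeneous_perturbation_class_def)
  have lin: "linear (\<lambda>u. a u v)" if "v \<in> Vh" for v
    using assms(4) that by (simp add: bilinear_form_on_def)

  define T where "T u = (\<Sum>e\<in>E. a u e *\<^sub>R e)" for u
  have "linear T"
  proof (rule linearI)
    show "T (x + y) = T x + T y" for x y
      unfolding T_def sum.distrib[symmetric]
      by (rule sum.cong) (use linear_add[OF lin] E(1) in \<open>auto simp: scaleR_add_left\<close>)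
    show "T (c *\<^sub>R x) = c *\<^sub>R T x" for c x
      unfolding T_def scaleR_sum_right
      by (rule sum.cong) (use linear_scale[OF lin] E(1) in auto)
  qed
  moreover have "T ` B \<subseteq> span E"
    by (auto simp: T_def span_base intro!: span_sum span_scale)
  ultimately obtain \<Phi> where \<Phi>: "\<Phi> \<in> span B" "\<Phi> \<noteq> 0" "T \<Phi> = 0"
    using exists_nonzero_in_kernel[of T B E] B E(4) finE by auto
  have "finite B"
    using B(2) by (simp add: card_ge_0_finite)
  then have in_H0: "\<Phi> \<in> H0"
    using closed_under_lincomb_span_subset[OF H0] B(1) \<Phi>(1) by blast
  have "a \<Phi> e = 0" if "e \<in> E" for e
    using independentD[OF E(2) finE subset_refl] \<Phi>(3) that by (simp add: T_def)
  then have ann: "a \<Phi> v = 0" if "v \<in> Vh" for v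
    using bilinear_form_on_eq_0_on_span[OF assms(4) V E(1)] E(3) that by blast
  have zero: "0 \<in> H0" "\<forall>v\<in>Vh. a 0 v = 0"
    using closed_under_lincomb_zero[OF H0] linear_0[OF lin] by auto
  have "solves_homogeneous a Vh H0 \<Phi>" "solves_homogeneous a Vh H0 0"
    using in_H0 ann zero by (auto simp: solves_homogeneous_def)
  then show ?thesis
    using \<Phi>(2) in_H0 ann zero(1) by blast
qed

end
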